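(* Let $\mathcal M=(\mathcal S,\Theta,\vec\pi)$ be a finite statistical model, $H_0\subseteq\Theta$, $h_1\in\Theta\setminus H_0$. Suppose $\Lambda$ is a deterministic uniformly least favorable distribution for the composite vs. simple test $H_0$ vs. $h_1$ under $\mathcal M$. Then for every $n\in\mathbb N$, $\Lambda$ is also a uniformly least favorable distribution for testing $H_0$ vs. $h_1$ under the model $(\mathcal S^n,\Theta,\vec\pi)$ with $n$ i.i.d. samples, i.e. with $\pi_\theta(x_1,\dots,x_n)=\prod_{i=1}^n\pi_\theta(x_i)$.
   Context: A statistical model $(\mathcal S,\Theta,\vec\pi)$ consists of a sample space $\mathcal S$, a parameter space $\Theta$ and probability distributions $\pi_\theta$ on $\mathcal S$ for $\theta\in\Theta$; it is finite if $\mathcal S$ and $\Theta$ are finite. A (randomized) test is a function $f:\mathcal S\to[0,1]$; $\mathrm{Size}(f,h_0)=E_{P\sim\pi_{h_0}}f(P)$, $\mathrm{Size}(f)=\sup_{h_0\in H_0}\mathrm{Size}(f,h_0)$, $\mathrm{Power}(f,h_1)=E_{P\sim\pi_{h_1}}f(P)$. A level-$\alpha$ most powerful test for $H_0$ vs. $h_1$ is a test of size $\alpha$ whose power at $h_1$ is maximal among all tests of size at most $\alpha$. Let $\Lambda$ be a probability distribution over $H_0$ with support $\mathrm{Spt}(\Lambda)$; it is deterministic if $|\mathrm{Spt}(\Lambda)|=1$. Let $\mathrm{Ratio}_{\Lambda,h_1}(P)=\dfrac{\pi_{h_1}(P)}{\sum_{h_0\in H_0}\Lambda(h_0)\pi_{h_0}(P)}$,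 assumed to be a well-defined positive real number for every sample $P$. For $0<\alpha<1$ the likelihood ratio test $\mathrm{LR}_{\alpha,\Lambda,h_1}(P)$ equals $1$ if $\mathrm{Ratio}_{\Lambda,h_1}(P)>k_\alpha$, $0$ if $\mathrm{Ratio}_{\Lambda,h_1}(P)<k_\alpha$, and $\gamma_\alpha$ if equality holds, where $k_\alpha\ge0$ and $\gamma_\alpha\in[0,1]$ are chosen so that $\sum_{h_0\in H_0}\Lambda(h_0)\,\mathrm{Size}(\mathrm{LR}_{\alpha,\Lambda,h_1},h_0)=\alpha$. $\Lambda$ is a (level-$\alpha$) least favorable distribution for $H_0$ vs. $h_1$ if $\mathrm{LR}_{\alpha,\Lambda,h_1}$ is a level-$\alpha$ most powerful test for $H_0$ vs. $h_1$; by a known result this is equivalent to: (i) $\mathrm{Size}(\mathrm{LR}_{\alpha,\Lambda,h_1},h_0^* )=\alpha$ for all $h_0^*\in\mathrm{Spt}(\Lambda)$ and (ii) $\mathrm{Size}(\mathrm{LR}_{\alpha,\Lambda,h_1},h_0)\le\alpha$ for all $h_0\in H_0$. $\Lambda$ is uniformly least favorable if this holds for all $0<\alpha<1$. *)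

theory Defs
  imports "HOL-Probability.Probability"
begin

record ('s, 't) stat_model =
  samples :: "'s set"
  params :: "'t set"
  dist :: "'t \<Rightarrow> 's pmf"

definition stat_model :: "('s, 't) stat_model \<Rightarrow> bool" where
  "stat_model M \<longleftrightarrow> (\<forall>\<theta>\<in>params M. set_pmf (dist M \<theta>) \<subseteq> samples M)"

definition finite_stat_model :: "('s, 't) stat_model \<Rightarrow> bool" where
  "finite_stat_model M \<longleftrightarrow> stat_model M \<and> finite (samples M) \<and> finite (params M)"

text \<open>Elements of the \<open>n\<close>-fold power of the sample space are lists of length \<open>n\<close>.\<close>

definition iid_model :: "nat \<Rightarrow> ('s, 't) stat_model \<Rightarrow> ('s list, 't) stat_model" where
  "iid_model n M =
    \<lparr>samples = {xs. set xs \<subseteq> samples M \<and> length xs = n},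
     params = params M,
     dist = (\<lambda>\<theta>. replicate_pmf n (dist M \<theta>))\<rparr>"

lemma pmf_replicate_pmf:
  assumes "length xs = n"
  shows "pmf (replicate_pmf n p) xs = (\<Prod>i<n. pmf p (xs ! i))"
  using assms
proof (induction n arbitrary: xs)
  case 0
  then show ?case by simp
next
  case (Suc n)
  then obtain y ys where xs: "xs = y # ys" "length ys = n"
    by (metis length_Suc_conv)
  have "pmf (replicate_pmf (Suc n) p) xs =
      pmf (map_pmf (\<lambda>(y, ys). y # ys) (pair_pmf p (replicate_pmf n p))) ((\<lambda>(y, ys). y # ys) (y, ys))"
    unfolding xs by (simp add: replicate_pmf.simps pair_pmf_def map_bind_pmf map_pmf_def
        bind_assoc_pmf bind_return_pmf)
  also have "\<dots> = pmf p y * pmf (replicate_pmf n p) ys"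
    by (subst pmf_map_inj') (auto simp: inj_def pmf_pair)
  also have "\<dots> = (\<Prod>i<Suc n. pmf p (xs ! i))"
    unfolding Suc.IH[OF xs(2)] unfolding xs prod.lessThan_Suc_shift by simp
  finally show ?case .
qed

lemma pmf_dist_iid_model:
  assumes "xs \<in> samples (iid_model n M)"
  shows "pmf (dist (iid_model n M) \<theta>) xs = (\<Prod>i<n. pmf (dist M \<theta>) (xs ! i))"
  using assms by (simp add: iid_model_def pmf_replicate_pmf)

definition is_test :: "('s, 't) stat_model \<Rightarrow> ('s \<Rightarrow> real) \<Rightarrow> bool" where
  "is_test M f \<longleftrightarrow> (\<forall>P\<in>samples M. 0 \<le> f P \<and> f P \<le> 1)"

definition size_at :: "('s, 't) stat_model \<Rightarrow> ('s \<Rightarrow> real) \<Rightarrow> 't \<Rightarrow> real" where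
  "size_at M f h0 = measure_pmf.expectation (dist M h0) f"

definition test_size :: "('s, 't) stat_model \<Rightarrow> 't set \<Rightarrow> ('s \<Rightarrow> real) \<Rightarrow> real" where
  "test_size M H0 f = (SUP h0\<in>H0. size_at M f h0)"

definition power_at :: "('s, 't) stat_model \<Rightarrow> ('s \<Rightarrow> real) \<Rightarrow> 't \<Rightarrow> real" where
  "power_at M f h1 = measure_pmf.expectation (dist M h1) f"

definition most_powerful ::
    "('s, 't) stat_model \<Rightarrow> 't set \<Rightarrow> 't \<Rightarrow> real \<Rightarrow> ('s \<Rightarrow> real) \<Rightarrow> bool" where
  "most_powerful M H0 h1 \<alpha> f \<longleftrightarrow>
     is_test M f \<and> test_size M H0 f = \<alpha> \<and>
     (\<forall>g. is_test M g \<and> test_size M H0 g \<le> \<alpha> \<longrightarrow> power_at M g h1 \<le> power_at M f h1)"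

definition mixture :: "('s, 't) stat_model \<Rightarrow> 't set \<Rightarrow> 't pmf \<Rightarrow> 's \<Rightarrow> real" where
  "mixture M H0 \<Lambda> P = (\<Sum>h0\<in>H0. pmf \<Lambda> h0 * pmf (dist M h0) P)"

definition ratio :: "('s, 't) stat_model \<Rightarrow> 't set \<Rightarrow> 't pmf \<Rightarrow> 't \<Rightarrow> 's \<Rightarrow> real" where
  "ratio M H0 \<Lambda> h1 P = pmf (dist M h1) P / mixture M H0 \<Lambda> P"

text \<open>As \<open>x / 0 = 0\<close>, being well-defined has to be required separately.\<close>

definition ratio_well_defined ::
    "('s, 't) stat_model \<Rightarrow> 't set \<Rightarrow> 't pmf \<Rightarrow> 't \<Rightarrow> bool" where
  "ratio_well_defined M H0 \<Lambda> h1 \<longleftrightarrow>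
     (\<forall>P\<in>samples M. mixture M H0 \<Lambda> P \<noteq> 0 \<and> ratio M H0 \<Lambda> h1 P > 0)"

definition threshold_test ::
    "('s, 't) stat_model \<Rightarrow> 't set \<Rightarrow> 't pmf \<Rightarrow> 't \<Rightarrow> real \<Rightarrow> real \<Rightarrow> 's \<Rightarrow> real" where
  "threshold_test M H0 \<Lambda> h1 k \<gamma> P =
     (if ratio M H0 \<Lambda> h1 P > k then 1 else if ratio M H0 \<Lambda> h1 P < k then 0 else \<gamma>)"

definition lr_constants ::
    "('s, 't) stat_model \<Rightarrow> 't set \<Rightarrow> 't pmf \<Rightarrow> 't \<Rightarrow> real \<Rightarrow> real \<Rightarrow> real \<Rightarrow> bool" where
  "lr_constants M H0 \<Lambda> h1 \<alpha> k \<gamma> \<longleftrightarrow>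
     0 \<le> k \<and> 0 \<le> \<gamma> \<and> \<gamma> \<le> 1 \<and>
     (\<Sum>h0\<in>H0. pmf \<Lambda> h0 * size_at M (threshold_test M H0 \<Lambda> h1 k \<gamma>) h0) = \<alpha>"

text \<open>
  For a finite model with well-defined ratio and \<open>0 < \<alpha> < 1\<close>, suitable constants exist.
  They need not be unique, but every choice gives the same test on the sample space: two threshold
  tests are pointwise comparable, and the mixture gives positive mass to every sample.
\<close>

definition LR :: "('s, 't) stat_model \<Rightarrow> 't set \<Rightarrow> 't pmf \<Rightarrow> 't \<Rightarrow> real \<Rightarrow> 's \<Rightarrow> real" where
  "LR M H0 \<Lambda> h1 \<alpha> =
     (let (k, \<gamma>) = (SOME (k, \<gamma>). lr_constants M H0 \<Lambda> h1 \<alpha> k \<gamma>)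
      in threshold_test M H0 \<Lambda> h1 k \<gamma>)"

definition deterministic :: "'t pmf \<Rightarrow> bool" where
  "deterministic \<Lambda> \<longleftrightarrow> card (set_pmf \<Lambda>) = 1"

definition least_favorable ::
    "('s, 't) stat_model \<Rightarrow> 't set \<Rightarrow> 't \<Rightarrow> real \<Rightarrow> 't pmf \<Rightarrow> bool" where
  "least_favorable M H0 h1 \<alpha> \<Lambda> \<longleftrightarrow>
     set_pmf \<Lambda> \<subseteq> H0 \<and> most_powerful M H0 h1 \<alpha> (LR M H0 \<Lambda> h1 \<alpha>)"

definition uniformly_least_favorable ::
    "('s, 't) stat_model \<Rightarrow> 't set \<Rightarrow> 't \<Rightarrow> 't pmf \<Rightarrow> bool" where
  "uniformly_least_favorable M H0 h1 \<Lambda> \<longleftrightarrow>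
     (\<forall>\<alpha>. 0 < \<alpha> \<and> \<alpha> < 1 \<longrightarrow> least_favorable M H0 h1 \<alpha> \<Lambda>)"

end

theory Submission
  imports Defs
begin

text \<open>
  Let \<open>\<Lambda>\<close> be the point mass at \<open>t \<in> H0\<close>, so that \<open>ratio\<close> is the simple likelihood ratio
  of \<open>h1\<close> against \<open>t\<close>. A likelihood ratio test rejects when this ratio is large,
  with size \<open>\<alpha>\<close> at \<open>t\<close>. That all these tests, for \<open>0 < \<alpha> < 1\<close>, keep their level on
  \<open>H0\<close> therefore means precisely that no \<open>h \<in> H0\<close> makes large ratios more likely than \<open>t\<close> does:
  the law of the ratio under \<open>h\<close> is stochastically below its law under \<open>t\<close>.
  One direction, \<open>uniformly_least_favorable_imp_stochastically_le\<close>, reads the tail event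
  \<open>ratio > k\<close> as the test of level \<open>\<alpha> = Pr\<^sub>t(ratio > k)\<close>; the other,
  \<open>stochastically_le_imp_uniformly_least_favorable\<close>, gets the level from the fact that threshold
  tests are monotone in the ratio and the optimality from the Neyman-Pearson lemma for \<open>t\<close>
  against \<open>h1\<close>.

  In this form the claim passes to independent samples. The ratio of a sample
  \<open>(x\<^sub>1, \<dots>, x\<^sub>n)\<close> is the product of the single ratios (\<open>map_ratio_iid_model\<close>), which are
  independent and nonnegative, and the stochastic order is preserved by products of such variables
  (\<open>stochastically_le_prod_list\<close>). A point mass is essential here: for a proper mixture the
  denominator of the ratio does not factor over the samples.
\<close>

section \<open>The stochastic order on real distributions\<close>

definition stochastically_le :: "real pmf \<Rightarrow> real pmf \<Rightarrow> bool" where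
  "stochastically_le X Y \<longleftrightarrow>
     (\<forall>k. measure_pmf.prob X {k<..} \<le> measure_pmf.prob Y {k<..})"

lemma stochastically_le_refl: "stochastically_le X X"
  by (simp add: stochastically_le_def)

lemma stochastically_le_trans [trans]:
  "stochastically_le X Y \<Longrightarrow> stochastically_le Y Z \<Longrightarrow> stochastically_le X Z"
  unfolding stochastically_le_def by (meson order_trans)

text \<open>
  A nonnegative monotone function is a nonnegative combination of indicators of upper sets. The
  induction peels off these indicators from below: on points above the least point \<open>b\<close>, subtracting
  the constant \<open>\<phi> b\<close> leaves a function of the same kind.
\<close>

lemma sum_mono_weighted_nonneg:
  fixes d \<phi> :: "real \<Rightarrow> real"
  assumes "finite A"
    and "\<And>k. 0 \<le> (\<Sum>v\<in>{v\<in>A. k < v}. d v)"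
    and "mono \<phi>" and "\<And>v. 0 \<le> \<phi> v"
  shows "0 \<le> (\<Sum>v\<in>A. \<phi> v * d v)"
  using assms
proof (induction A arbitrary: \<phi> rule: finite_linorder_min_induct)
  case empty
  then show ?case by simp
next
  case (insert b A)
  \<comment> \<open>The truncation at 0 only matters off \<open>A\<close>; it makes the function nonnegative everywhere.\<close>
  let ?\<psi> = "\<lambda>v. max 0 (\<phi> v - \<phi> b)"
  have tails: "0 \<le> (\<Sum>v\<in>{v\<in>A. k < v}. d v)" for k
  proof -
    have "{v\<in>A. k < v} = {v\<in>insert b A. max k b < v}"
      using insert.hyps(2) by auto
    then show ?thesis using insert.prems(1)[of "max k b"] by simp
  qed
  have "mono ?\<psi>"
    using insert.prems(2) by (auto simp: mono_def max_def intro: order_trans)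
  then have "0 \<le> (\<Sum>v\<in>A. ?\<psi> v * d v)"
    using insert.IH[of ?\<psi>] tails by simp
  also have "\<dots> = (\<Sum>v\<in>A. \<phi> v * d v) - \<phi> b * (\<Sum>v\<in>A. d v)"
  proof -
    have "?\<psi> v = \<phi> v - \<phi> b" if "v \<in> A" for v
      using monoD[OF insert.prems(2), of b v] insert.hyps(2) that by fastforce
    then have "(\<Sum>v\<in>A. ?\<psi> v * d v) = (\<Sum>v\<in>A. (\<phi> v - \<phi> b) * d v)"
      by (intro sum.cong) simp_all
    then show ?thesis
      by (simp only: left_diff_distrib sum_subtractf sum_distrib_left)
  qed
  finally have *: "\<phi> b * (\<Sum>v\<in>A. d v) \<le> (\<Sum>v\<in>A. \<phi> v * d v)" by simp
  have "{v\<in>insert b A. b - 1 < v} = insert b A"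
    using insert.hyps(2) by force
  then have "0 \<le> (\<Sum>v\<in>insert b A. d v)"
    using insert.prems(1)[of "b - 1"] by simp
  then have "0 \<le> \<phi> b * (\<Sum>v\<in>insert b A. d v)"
    using insert.prems(3) by simp
  moreover have "b \<notin> A" using insert.hyps(2) by auto
  ultimately show ?case
    using * insert.hyps(1) by (simp add: algebra_simps)
qed

lemma stochastically_le_expectation_mono:
  fixes \<phi> :: "real \<Rightarrow> real"
  assumes "stochastically_le X Y"
    and "finite (set_pmf X)" "finite (set_pmf Y)"
    and "mono \<phi>" "\<And>v. 0 \<le> \<phi> v"
  shows "measure_pmf.expectation X \<phi> \<le> measure_pmf.expectation Y \<phi>"
proof -
  define A where "A = set_pmf X \<union> set_pmf Y"
  have fin: "finite A" using assms by (simp add: A_def)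
  have tail: "measure_pmf.prob Z {k<..} = (\<Sum>v\<in>{v\<in>A. k < v}. pmf Z v)"
    if "set_pmf Z \<subseteq> A" for Z k
  proof -
    have "measure_pmf.prob Z {k<..} = measure_pmf.prob Z {v\<in>A. k < v}"
      by (rule measure_prob_cong_0) (use that in \<open>auto simp: set_pmf_iff\<close>)
    then show ?thesis by (simp add: measure_measure_pmf_finite fin)
  qed
  have expect: "measure_pmf.expectation Z \<phi> = (\<Sum>v\<in>A. \<phi> v * pmf Z v)"
    if "set_pmf Z \<subseteq> A" for Z
    by (rule integral_measure_pmf_real) (use fin that in auto)
  have "0 \<le> (\<Sum>v\<in>{v\<in>A. k < v}. pmf Y v - pmf X v)" for k
    using assms(1) tail[of X k] tail[of Y k]
    by (auto simp: stochastically_le_def sum_subtractf A_def dest: spec[of _ k])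
  then have "0 \<le> (\<Sum>v\<in>A. \<phi> v * (pmf Y v - pmf X v))"
    by (rule sum_mono_weighted_nonneg[OF fin]) (use assms in auto)
  then show ?thesis
    using expect[of X] expect[of Y] by (simp add: A_def algebra_simps sum_subtractf)
qed

lemma stochastically_le_map:
  assumes "stochastically_le X Y"
    and "finite (set_pmf X)" "finite (set_pmf Y)"
    and "mono f"
  shows "stochastically_le (map_pmf f X) (map_pmf f Y)"
  unfolding stochastically_le_def
proof
  fix k
  have "measure_pmf.expectation X (indicator (f -` {k<..}) :: real \<Rightarrow> real)
      \<le> measure_pmf.expectation Y (indicator (f -` {k<..}))"
    by (rule stochastically_le_expectation_mono[OF assms(1-3)])
      (use monoD[OF assms(4)] in
        \<open>auto simp: mono_def indicator_def dest: order.strict_trans2\<close>)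
  then show "measure_pmf.prob (map_pmf f X) {k<..} \<le> measure_pmf.prob (map_pmf f Y) {k<..}"
    by simp
qed

lemma stochastically_le_bind:
  assumes "\<And>z. z \<in> set_pmf Z \<Longrightarrow> stochastically_le (F z) (G z)"
  shows "stochastically_le (bind_pmf Z F) (bind_pmf Z G)"
  unfolding stochastically_le_def
proof
  fix k
  have "emeasure (bind_pmf Z F) {k<..} \<le> emeasure (bind_pmf Z G) {k<..}"
    unfolding emeasure_bind_pmf
    by (rule nn_integral_mono_AE)
      (use assms in \<open>auto simp: AE_measure_pmf_iff stochastically_le_def
         measure_pmf.emeasure_eq_measure\<close>)
  then show "measure_pmf.prob (bind_pmf Z F) {k<..} \<le> measure_pmf.prob (bind_pmf Z G) {k<..}"
    by (simp add: measure_pmf.emeasure_eq_measure del: emeasure_bind_pmf)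
qed

lemma finite_set_replicate_pmf:
  "finite (set_pmf p) \<Longrightarrow> finite (set_pmf (replicate_pmf n p))"
  using finite_lists_length_eq[of "set_pmf p" n]
  by (simp add: set_replicate_pmf lists_eq_set)

text \<open>
  The \<open>n\<close>-fold product under \<open>X\<close> is changed into the one under \<open>Y\<close> one factor at a time. Given the
  value of the other factors, which is nonnegative, multiplication by it is monotone and preserves
  the order; averaging over that value preserves it too.
\<close>

lemma stochastically_le_prod_list:
  assumes le: "stochastically_le X Y"
    and fin: "finite (set_pmf X)" "finite (set_pmf Y)"
    and nonneg: "\<And>x. x \<in> set_pmf X \<Longrightarrow> 0 \<le> x" "\<And>y. y \<in> set_pmf Y \<Longrightarrow> 0 \<le> y"
  shows "stochastically_le (map_pmf prod_list (replicate_pmf n X))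
           (map_pmf prod_list (replicate_pmf n Y))"
proof (induction n)
  case 0
  then show ?case by (simp add: stochastically_le_refl)
next
  case (Suc n)
  define P where "P Z = map_pmf prod_list (replicate_pmf n Z)" for Z :: "real pmf"
  have finP: "finite (set_pmf (P Z))" if "finite (set_pmf Z)" for Z
    using finite_set_replicate_pmf[OF that] by (simp add: P_def)
  have P_Suc: "map_pmf prod_list (replicate_pmf (Suc n) Z)
      = bind_pmf Z (\<lambda>x. map_pmf (\<lambda>v. x * v) (P Z))" for Z
    by (simp add: P_def map_pmf_def bind_assoc_pmf bind_return_pmf)
  \<comment> \<open>By independence, either factor of the product may be drawn first.\<close>
  have swap: "bind_pmf X (\<lambda>x. map_pmf (\<lambda>v. x * v) (P Y))
      = bind_pmf (P Y) (\<lambda>v. map_pmf (\<lambda>x. x * v) X)" for X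
    unfolding map_pmf_def by (rule bind_commute_pmf)
  have nonnegP: "0 \<le> v" if "v \<in> set_pmf (P Y)" for v
    using that nonneg(2) by (auto simp: P_def set_replicate_pmf intro!: prod_list_nonneg)
  have "stochastically_le (bind_pmf X (\<lambda>x. map_pmf (\<lambda>v. x * v) (P X)))
      (bind_pmf X (\<lambda>x. map_pmf (\<lambda>v. x * v) (P Y)))"
    by (intro stochastically_le_bind stochastically_le_map finP fin Suc.IH[folded P_def])
      (auto simp: mono_def nonneg intro!: mult_left_mono)
  also have "stochastically_le (bind_pmf X (\<lambda>x. map_pmf (\<lambda>v. x * v) (P Y)))
      (bind_pmf Y (\<lambda>x. map_pmf (\<lambda>v. x * v) (P Y)))"
    unfolding swap
    by (intro stochastically_le_bind stochastically_le_map fin le)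
      (auto simp: mono_def nonnegP intro!: mult_right_mono)
  finally show ?case unfolding P_Suc .
qed

section \<open>Randomized threshold tests\<close>

text \<open>
  The critical value is the least score whose strict upper tail has mass at most \<open>\<alpha>\<close>. By
  minimality the tail that includes this score has mass at least \<open>\<alpha>\<close>, so randomizing on the
  boundary fills the gap exactly. That the critical value is an attained score gives the boundary
  positive mass and, for likelihood ratios, makes the critical value positive.
\<close>

lemma randomized_quantile_exists:
  fixes r :: "'a \<Rightarrow> real" and \<alpha> :: real
  assumes fin: "finite (set_pmf p)" and \<alpha>: "0 \<le> \<alpha>" "\<alpha> \<le> 1"
  shows "\<exists>k\<in>r ` set_pmf p. \<exists>\<gamma>. 0 \<le> \<gamma> \<and> \<gamma> \<le> 1 \<and>
    measure_pmf.expectation p (\<lambda>s. if k < r s then 1 else if r s < k then 0 else \<gamma>) = \<alpha>"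
proof -
  define A where "A = r ` set_pmf p"
  define U where "U k = measure_pmf.prob p {s. k < r s}" for k
  define V where "V k = measure_pmf.prob p {s. k = r s}" for k
  have finA: "finite A" and neA: "A \<noteq> {}"
    using fin by (auto simp: A_def set_pmf_not_empty)
  define K where "K = {k\<in>A. U k \<le> \<alpha>}"
  have "U (Max A) = 0"
    unfolding U_def measure_pmf_zero_iff using Max_ge[OF finA] by (force simp: A_def not_less)
  then have "Max A \<in> K" using Max_in[OF finA neA] \<alpha> by (simp add: K_def)
  then have K: "finite K" "K \<noteq> {}" using finA by (auto simp: K_def)
  define k where "k = Min K"
  have kA: "k \<in> A" and Uk: "U k \<le> \<alpha>"
    using Min_in[OF K] by (auto simp: k_def K_def)
  have UV: "U k + V k = measure_pmf.prob p {s. k \<le> r s}"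
    unfolding U_def V_def
    by (subst measure_pmf.finite_measure_Union[symmetric]) (auto intro!: arg_cong[where f = "measure_pmf.prob p"])
  have UV_ge: "\<alpha> \<le> U k + V k"
  proof (cases "\<exists>a\<in>A. a < k")
    case True
    define B where "B = {a\<in>A. a < k}"
    have B: "finite B" "B \<noteq> {}" using finA True by (auto simp: B_def)
    define b where "b = Max B"
    have b: "b \<in> A" "b < k" using Max_in[OF B] by (auto simp: b_def B_def)
    have "a \<le> b" if "a \<in> A" "a < k" for a
      using Max_ge[OF B(1), of a] that by (auto simp: b_def B_def)
    \<comment> \<open>No score lies strictly between \<open>b\<close> and \<open>k\<close>.\<close>
    then have "U b = measure_pmf.prob p {s. k \<le> r s}"
      unfolding U_def using b
      by (intro measure_prob_cong_0) (force simp: A_def set_pmf_iff not_less not_le)+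
    moreover have "b \<notin> K" using Min_le[OF K(1), of b] b by (auto simp: k_def)
    ultimately show ?thesis using b UV by (simp add: K_def)
  next
    case False
    then have "measure_pmf.prob p {s. k \<le> r s} = 1"
      by (subst measure_pmf.prob_eq_1) (auto simp: AE_measure_pmf_iff A_def not_less)
    then show ?thesis using UV \<alpha> by simp
  qed
  have Vpos: "0 < V k"
    unfolding V_def using kA by (auto simp: A_def measure_pmf_posI)
  define \<gamma> where "\<gamma> = (\<alpha> - U k) / V k"
  have "0 \<le> \<gamma>" "\<gamma> \<le> 1" "U k + \<gamma> * V k = \<alpha>"
    using Uk UV_ge Vpos by (auto simp: \<gamma>_def field_simps)
  moreover have "measure_pmf.expectation p (\<lambda>s. if k < r s then 1 else if r s < k then 0 else \<gamma>)
      = U k + \<gamma> * V k"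
  proof -
    have "measure_pmf.expectation p (\<lambda>s. if k < r s then 1 else if r s < k then 0 else \<gamma>)
      = measure_pmf.expectation p
          (\<lambda>s. indicator {s. k < r s} s + \<gamma> * indicator {s. k = r s} s)"
      by (intro Bochner_Integration.integral_cong) (auto simp: indicator_def)
    also have "\<dots> = U k + \<gamma> * V k"
      unfolding U_def V_def
      by (subst Bochner_Integration.integral_add)
        (auto intro!: integrable_measure_pmf_finite fin)
    finally show ?thesis .
  qed
  ultimately show ?thesis using kA unfolding A_def by auto
qed

text \<open>
  Pointwise, \<open>f\<close> is on the right side of every competitor \<open>g\<close>:
  \<open>(f s - g s) * (pmf q s - k * pmf p s) \<ge> 0\<close>. Summing over \<open>s\<close> bounds the gain in power from below
  by \<open>k\<close> times the gain in size. The rejection rule is phrased without a quotient, which also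
  covers points where \<open>p\<close> vanishes.
\<close>

lemma neyman_pearson:
  fixes f g :: "'a \<Rightarrow> real"
  assumes fin: "finite S" and supp: "set_pmf p \<subseteq> S" "set_pmf q \<subseteq> S" and k: "0 \<le> k"
    and rej: "\<And>s. s \<in> S \<Longrightarrow> k * pmf p s < pmf q s \<Longrightarrow> f s = 1"
    and acc: "\<And>s. s \<in> S \<Longrightarrow> pmf q s < k * pmf p s \<Longrightarrow> f s = 0"
    and g: "\<And>s. s \<in> S \<Longrightarrow> 0 \<le> g s \<and> g s \<le> 1"
    and size: "measure_pmf.expectation p g \<le> measure_pmf.expectation p f"
  shows "measure_pmf.expectation q g \<le> measure_pmf.expectation q f"
proof -
  have E: "measure_pmf.expectation r h = (\<Sum>s\<in>S. h s * pmf r s)"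
    if "r \<in> {p, q}" for r and h :: "'a \<Rightarrow> real"
    using that supp by (intro integral_measure_pmf_real[OF fin]) auto
  have "0 \<le> (\<Sum>s\<in>S. (f s - g s) * (pmf q s - k * pmf p s))"
  proof (rule sum_nonneg)
    fix s assume s: "s \<in> S"
    show "0 \<le> (f s - g s) * (pmf q s - k * pmf p s)"
    proof (cases "pmf q s" "k * pmf p s" rule: linorder_cases)
      case less
      then show ?thesis using acc[OF s] g[OF s] by (intro mult_nonpos_nonpos) auto
    next
      case greater
      then show ?thesis using rej[OF s] g[OF s] by (intro mult_nonneg_nonneg) auto
    qed simp
  qed
  also have "\<dots> = (measure_pmf.expectation q f - measure_pmf.expectation q g)
      - k * (measure_pmf.expectation p f - measure_pmf.expectation p g)"
    by (simp add: E algebra_simps sum_subtractf sum.distrib sum_distrib_left)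
  finally have "k * (measure_pmf.expectation p f - measure_pmf.expectation p g)
      \<le> measure_pmf.expectation q f - measure_pmf.expectation q g" by simp
  moreover have "0 \<le> k * (measure_pmf.expectation p f - measure_pmf.expectation p g)"
    using k size by simp
  ultimately show ?thesis by simp
qed

section \<open>Point-mass least favorable distributions as stochastic dominance\<close>

lemma sum_return_pmf:
  assumes "finite A" "t \<in> A"
  shows "(\<Sum>x\<in>A. pmf (return_pmf t) x * F x) = (F t :: real)"
proof -
  have "(\<Sum>x\<in>A. pmf (return_pmf t) x * F x) = (\<Sum>x\<in>A. if x = t then F x else 0)"
    by (intro sum.cong) (auto simp: pmf_return indicator_def)
  then show ?thesis using assms by simp
qed

lemma mixture_return_pmf:
  "finite H0 \<Longrightarrow> t \<in> H0 \<Longrightarrow> mixture M H0 (return_pmf t) P = pmf (dist M t) P"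
  unfolding mixture_def by (rule sum_return_pmf)

lemma lr_constants_return_pmf:
  assumes "finite H0" "t \<in> H0"
  shows "lr_constants M H0 (return_pmf t) h1 \<alpha> k \<gamma> \<longleftrightarrow>
    0 \<le> k \<and> 0 \<le> \<gamma> \<and> \<gamma> \<le> 1 \<and> size_at M (threshold_test M H0 (return_pmf t) h1 k \<gamma>) t = \<alpha>"
  unfolding lr_constants_def sum_return_pmf[OF assms] ..

text \<open>
  \<open>LR\<close> picks its constants by choice; this lemma makes the choice meaningful by
  exhibiting constants.
\<close>

lemma lr_constants_exist:
  assumes M: "finite_stat_model M" and H0: "H0 \<subseteq> params M" and t: "t \<in> H0"
    and rat: "ratio_well_defined M H0 (return_pmf t) h1"
    and \<alpha>: "0 < \<alpha>" "\<alpha> < 1"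
  obtains k \<gamma> where "lr_constants M H0 (return_pmf t) h1 \<alpha> k \<gamma>"
    "LR M H0 (return_pmf t) h1 \<alpha> = threshold_test M H0 (return_pmf t) h1 k \<gamma>"
proof -
  let ?r = "ratio M H0 (return_pmf t) h1"
  have finH0: "finite H0" and sub: "set_pmf (dist M t) \<subseteq> samples M" "finite (samples M)"
    using M H0 t by (auto simp: finite_stat_model_def stat_model_def intro: finite_subset)
  have "\<exists>k\<in>?r ` set_pmf (dist M t). \<exists>\<gamma>. 0 \<le> \<gamma> \<and> \<gamma> \<le> 1 \<and>
    measure_pmf.expectation (dist M t)
      (\<lambda>s. if k < ?r s then 1 else if ?r s < k then 0 else \<gamma>) = \<alpha>"
    by (rule randomized_quantile_exists) (use sub \<alpha> in \<open>auto intro: finite_subset\<close>)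
  then obtain k \<gamma> where k: "k \<in> ?r ` set_pmf (dist M t)" and \<gamma>: "0 \<le> \<gamma>" "\<gamma> \<le> 1"
    and E: "size_at M (threshold_test M H0 (return_pmf t) h1 k \<gamma>) t = \<alpha>"
    unfolding size_at_def threshold_test_def by blast
  have "0 \<le> k"
    using k rat sub by (auto simp: ratio_well_defined_def intro: less_imp_le)
  with \<gamma> E have "lr_constants M H0 (return_pmf t) h1 \<alpha> k \<gamma>"
    using finH0 t by (simp add: lr_constants_return_pmf)
  then have ex: "\<exists>z. case z of (k, \<gamma>) \<Rightarrow> lr_constants M H0 (return_pmf t) h1 \<alpha> k \<gamma>"
    by auto
  obtain k' \<gamma>' where z:
    "(SOME (k, \<gamma>). lr_constants M H0 (return_pmf t) h1 \<alpha> k \<gamma>) = (k', \<gamma>')"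
    by fastforce
  have "lr_constants M H0 (return_pmf t) h1 \<alpha> k' \<gamma>'"
    using someI_ex[OF ex] unfolding z by simp
  moreover have "LR M H0 (return_pmf t) h1 \<alpha> = threshold_test M H0 (return_pmf t) h1 k' \<gamma>'"
    by (simp add: LR_def z)
  ultimately show thesis by (rule that)
qed

lemma size_at_le_test_size:
  "finite H0 \<Longrightarrow> h \<in> H0 \<Longrightarrow> size_at M f h \<le> test_size M H0 f"
  unfolding test_size_def by (intro cSUP_upper) auto

lemma is_test_threshold_test:
  "0 \<le> \<gamma> \<Longrightarrow> \<gamma> \<le> 1 \<Longrightarrow> is_test M (threshold_test M H0 \<Lambda> h1 k \<gamma>)"
  by (simp add: is_test_def threshold_test_def)

lemma size_at_eq_sum:
  assumes "finite_stat_model M" "h \<in> params M"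
  shows "size_at M f h = (\<Sum>s\<in>samples M. f s * pmf (dist M h) s)"
  unfolding size_at_def using assms
  by (intro integral_measure_pmf_real) (auto simp: finite_stat_model_def stat_model_def)

lemma size_at_mono:
  assumes "finite_stat_model M" "h \<in> params M" "\<And>s. s \<in> samples M \<Longrightarrow> f s \<le> g s"
  shows "size_at M f h \<le> size_at M g h"
  unfolding size_at_eq_sum[OF assms(1,2)] using assms(3)
  by (intro sum_mono mult_right_mono) auto

text \<open>
  The indicator of \<open>ratio > k\<close> is itself a test, of size \<open>\<alpha>\<close> at \<open>t\<close>, say. If \<open>0 < \<alpha> < 1\<close>, it is
  bounded on the sample space by the likelihood ratio test of level \<open>\<alpha>\<close>, whose size at \<open>h\<close> is at
  most \<open>\<alpha>\<close> because that test is most powerful. In the extreme cases, where the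
  hypothesis gives no test, the bound is immediate: if \<open>\<alpha> = 0\<close>, no sample has a ratio above \<open>k\<close>,
  since \<open>t\<close> charges every sample, and \<open>\<alpha> = 1\<close> bounds every probability.
\<close>

lemma uniformly_least_favorable_imp_stochastically_le:
  assumes M: "finite_stat_model M" and H0: "H0 \<subseteq> params M" and t: "t \<in> H0" and h: "h \<in> H0"
    and rat: "ratio_well_defined M H0 (return_pmf t) h1"
    and lf: "uniformly_least_favorable M H0 h1 (return_pmf t)"
  shows "stochastically_le (map_pmf (ratio M H0 (return_pmf t) h1) (dist M h))
           (map_pmf (ratio M H0 (return_pmf t) h1) (dist M t))"
  unfolding stochastically_le_def
proof
  fix k
  let ?r = "ratio M H0 (return_pmf t) h1"
  let ?T = "threshold_test M H0 (return_pmf t) h1"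
  define f where "f s = (indicator {s. k < ?r s} s :: real)" for s
  have finH0: "finite H0" and finS: "finite (samples M)"
    using M H0 by (auto simp: finite_stat_model_def intro: finite_subset)
  have pos: "0 < pmf (dist M t) s" if "s \<in> samples M" for s
    using rat that finH0 t by (auto simp: ratio_well_defined_def mixture_return_pmf less_le)
  define \<alpha> where "\<alpha> = size_at M f t"
  have prob: "measure_pmf.prob (map_pmf ?r (dist M h')) {k<..} = size_at M f h'" for h'
    by (simp add: size_at_def f_def[abs_def] vimage_def)
  have "0 \<le> \<alpha>" "\<alpha> \<le> 1"
    unfolding \<alpha>_def prob[symmetric] by auto
  then consider "\<alpha> = 0" | "\<alpha> = 1" | "0 < \<alpha>" "\<alpha> < 1" by linarith
  then have "size_at M f h \<le> \<alpha>"
  proof cases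
    case 1
    have "(\<Sum>s\<in>samples M. f s * pmf (dist M t) s) = 0"
      using 1 H0 t by (simp add: \<alpha>_def size_at_eq_sum[OF M] subset_iff)
    then have "f s = 0" if "s \<in> samples M" for s
      using that pos by (subst (asm) sum_nonneg_eq_0_iff) (force simp: finS f_def)+
    then show ?thesis using 1 H0 h by (simp add: size_at_eq_sum[OF M] subset_iff)
  next
    case 2
    then show ?thesis unfolding prob[symmetric] by simp
  next
    case 3
    obtain k' \<gamma>' where c: "lr_constants M H0 (return_pmf t) h1 \<alpha> k' \<gamma>'"
      and LR: "LR M H0 (return_pmf t) h1 \<alpha> = ?T k' \<gamma>'"
      using lr_constants_exist[OF M H0 t rat 3] .
    have \<gamma>': "0 \<le> \<gamma>'" "\<gamma>' \<le> 1" and sz: "size_at M (?T k' \<gamma>') t = \<alpha>"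
      using c finH0 t by (simp_all add: lr_constants_return_pmf)
    have "most_powerful M H0 h1 \<alpha> (?T k' \<gamma>')"
      using lf 3 unfolding LR[symmetric]
      by (simp add: uniformly_least_favorable_def least_favorable_def)
    then have size_h: "size_at M (?T k' \<gamma>') h \<le> \<alpha>"
      using size_at_le_test_size[OF finH0 h] by (auto simp: most_powerful_def)
    have "f s \<le> ?T k' \<gamma>' s" if s: "s \<in> samples M" for s
    proof (cases "k' \<le> k")
      case True
      then show ?thesis using \<gamma>' by (auto simp: f_def threshold_test_def)
    next
      case False
      \<comment> \<open>Here the comparison goes the wrong way, but both tests have size \<open>\<alpha>\<close> at \<open>t\<close>, so they
        agree wherever \<open>t\<close> has mass, that is, on all samples.\<close>
      have le: "?T k' \<gamma>' s \<le> f s" for s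
        using \<gamma>' False by (auto simp: f_def threshold_test_def)
      have "(\<Sum>s\<in>samples M. (f s - ?T k' \<gamma>' s) * pmf (dist M t) s) = 0"
        using sz H0 t
        by (simp add: \<alpha>_def size_at_eq_sum[OF M] subset_iff left_diff_distrib sum_subtractf)
      then have "(f s - ?T k' \<gamma>' s) * pmf (dist M t) s = 0"
        using s le by (subst (asm) sum_nonneg_eq_0_iff) (auto simp: finS)
      then show ?thesis using pos[OF s] by simp
    qed
    then have "size_at M f h \<le> size_at M (?T k' \<gamma>') h"
      using M H0 h by (intro size_at_mono) auto
    with size_h show ?thesis by simp
  qed
  then show "measure_pmf.prob (map_pmf ?r (dist M h)) {k<..}
      \<le> measure_pmf.prob (map_pmf ?r (dist M t)) {k<..}"
    unfolding prob \<alpha>_def .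
qed

text \<open>
  A threshold test is a monotone function \<open>\<phi>\<close> of the ratio, so its size at each \<open>h \<in> H0\<close> is at most
  its size \<open>\<alpha>\<close> at \<open>t\<close>. A competitor of size at most \<open>\<alpha>\<close> on \<open>H0\<close> has size at most \<open>\<alpha>\<close> at \<open>t\<close> in particular,
  and already for the simple problem \<open>t\<close> against \<open>h1\<close> it cannot beat the likelihood ratio test.
\<close>

lemma stochastically_le_imp_uniformly_least_favorable:
  assumes M: "finite_stat_model M" and H0: "H0 \<subseteq> params M" and t: "t \<in> H0"
    and h1: "h1 \<in> params M"
    and rat: "ratio_well_defined M H0 (return_pmf t) h1"
    and le: "\<And>h. h \<in> H0 \<Longrightarrow>
      stochastically_le (map_pmf (ratio M H0 (return_pmf t) h1) (dist M h))
        (map_pmf (ratio M H0 (return_pmf t) h1) (dist M t))"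
  shows "uniformly_least_favorable M H0 h1 (return_pmf t)"
  unfolding uniformly_least_favorable_def least_favorable_def
proof (intro allI impI conjI)
  fix \<alpha> :: real assume "0 < \<alpha> \<and> \<alpha> < 1"
  then have \<alpha>: "0 < \<alpha>" "\<alpha> < 1" by auto
  show "set_pmf (return_pmf t) \<subseteq> H0" using t by simp
  let ?r = "ratio M H0 (return_pmf t) h1"
  obtain k \<gamma> where c: "lr_constants M H0 (return_pmf t) h1 \<alpha> k \<gamma>"
    and LR: "LR M H0 (return_pmf t) h1 \<alpha> = threshold_test M H0 (return_pmf t) h1 k \<gamma>"
    using lr_constants_exist[OF M H0 t rat \<alpha>] .
  let ?T = "threshold_test M H0 (return_pmf t) h1 k \<gamma>"
  have finH0: "finite H0" and finS: "finite (samples M)"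
    and sub: "\<And>h. h \<in> params M \<Longrightarrow> set_pmf (dist M h) \<subseteq> samples M"
    using M H0 by (auto simp: finite_stat_model_def stat_model_def intro: finite_subset)
  have fin: "finite (set_pmf (dist M h))" if "h \<in> params M" for h
    using sub[OF that] finS by (rule finite_subset)
  have pos: "0 < pmf (dist M t) s" if "s \<in> samples M" for s
    using rat that finH0 t by (auto simp: ratio_well_defined_def mixture_return_pmf less_le)
  have k: "0 \<le> k" and \<gamma>: "0 \<le> \<gamma>" "\<gamma> \<le> 1" and size_t: "size_at M ?T t = \<alpha>"
    using c finH0 t by (simp_all add: lr_constants_return_pmf)
  define \<phi> where "\<phi> v = (if k < v then 1 else if v < k then 0 else \<gamma>)" for v
  have \<phi>: "mono \<phi>" "0 \<le> \<phi> v" for v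
    using \<gamma> by (auto simp: \<phi>_def mono_def)
  have size_eq: "size_at M ?T h = measure_pmf.expectation (map_pmf ?r (dist M h)) \<phi>" for h
    by (simp add: size_at_def threshold_test_def[abs_def] \<phi>_def)
  have size_h: "size_at M ?T h \<le> \<alpha>" if h: "h \<in> H0" for h
    unfolding size_t[symmetric] size_eq
    by (rule stochastically_le_expectation_mono[OF le[OF h] _ _ \<phi>]) (use h t H0 fin in auto)
  have "test_size M H0 ?T = \<alpha>"
  proof (rule antisym)
    show "test_size M H0 ?T \<le> \<alpha>"
      unfolding test_size_def using t size_h by (intro cSUP_least) auto
    show "\<alpha> \<le> test_size M H0 ?T"
      using size_at_le_test_size[OF finH0 t, of M ?T] size_t by simp
  qed
  moreover have "power_at M g h1 \<le> power_at M ?T h1"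
    if g: "is_test M g" "test_size M H0 g \<le> \<alpha>" for g
    unfolding power_at_def
  proof (rule neyman_pearson[OF finS _ _ k])
    show "set_pmf (dist M t) \<subseteq> samples M" "set_pmf (dist M h1) \<subseteq> samples M"
      using sub t h1 H0 by auto
    show "measure_pmf.expectation (dist M t) g \<le> measure_pmf.expectation (dist M t) ?T"
      using size_at_le_test_size[OF finH0 t, of M g] g(2) size_t by (simp add: size_at_def)
  qed (use pos finH0 t g(1) in
      \<open>auto simp: threshold_test_def ratio_def mixture_return_pmf is_test_def field_simps\<close>)
  ultimately show "most_powerful M H0 h1 \<alpha> (LR M H0 (return_pmf t) h1 \<alpha>)"
    unfolding LR most_powerful_def using is_test_threshold_test[OF \<gamma>] by auto
qed

section \<open>Independent samples\<close>

lemma finite_stat_model_iid_model: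
  assumes "finite_stat_model M"
  shows "finite_stat_model (iid_model n M)"
  using assms finite_lists_length_eq[of "samples M" n]
  by (fastforce simp: finite_stat_model_def stat_model_def iid_model_def set_replicate_pmf)

lemma map_replicate_pmf:
  "map_pmf (map f) (replicate_pmf n p) = replicate_pmf n (map_pmf f p)"
proof (induction n)
  case (Suc n)
  show ?case
    by (simp add: Suc.IH[unfolded map_pmf_def, symmetric] map_pmf_def bind_assoc_pmf bind_return_pmf)
qed simp

lemma ratio_iid_model:
  assumes "finite H0" "t \<in> H0" "xs \<in> samples (iid_model n M)"
  shows "ratio (iid_model n M) H0 (return_pmf t) h1 xs
       = prod_list (map (ratio M H0 (return_pmf t) h1) xs)"
proof -
  have "length xs = n" using assms(3) by (simp add: iid_model_def)
  then show ?thesis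
    using assms
    by (simp add: ratio_def mixture_return_pmf pmf_dist_iid_model prod_dividef
        prod.list_conv_set_nth atLeast0LessThan)
qed

lemma ratio_well_defined_iid_model:
  assumes "finite H0" "t \<in> H0" and rat: "ratio_well_defined M H0 (return_pmf t) h1"
  shows "ratio_well_defined (iid_model n M) H0 (return_pmf t) h1"
  unfolding ratio_well_defined_def
proof (intro ballI conjI)
  fix xs assume xs: "xs \<in> samples (iid_model n M)"
  then have mem: "x \<in> samples M" if "x \<in> set xs" for x
    using that by (auto simp: iid_model_def)
  have len: "length xs = n" using xs by (simp add: iid_model_def)
  show "mixture (iid_model n M) H0 (return_pmf t) xs \<noteq> 0"
    using rat mem[OF nth_mem] assms(1,2) len
    by (simp add: mixture_return_pmf pmf_dist_iid_model[OF xs] ratio_well_defined_def)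
  have "0 < prod_list (map (ratio M H0 (return_pmf t) h1) xs)"
    using rat mem by (induction xs) (auto simp: ratio_well_defined_def)
  then show "0 < ratio (iid_model n M) H0 (return_pmf t) h1 xs"
    using ratio_iid_model[OF assms(1,2) xs] by simp
qed

lemma map_ratio_iid_model:
  assumes "finite_stat_model M" "H0 \<subseteq> params M" "t \<in> H0" "h \<in> params M"
  shows "map_pmf (ratio (iid_model n M) H0 (return_pmf t) h1) (dist (iid_model n M) h)
       = map_pmf prod_list (replicate_pmf n (map_pmf (ratio M H0 (return_pmf t) h1) (dist M h)))"
proof -
  have "finite H0" "set_pmf (dist (iid_model n M) h) \<subseteq> samples (iid_model n M)"
    using assms finite_stat_model_iid_model[OF assms(1), of n]
    by (auto simp: finite_stat_model_def stat_model_def iid_model_def intro: finite_subset)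
  then have "map_pmf (ratio (iid_model n M) H0 (return_pmf t) h1) (dist (iid_model n M) h)
      = map_pmf (\<lambda>xs. prod_list (map (ratio M H0 (return_pmf t) h1) xs)) (dist (iid_model n M) h)"
    using assms(3) by (intro map_pmf_cong) (auto intro!: ratio_iid_model)
  then show ?thesis
    by (simp add: map_replicate_pmf[symmetric] pmf.map_comp o_def iid_model_def)
qed

theorem lemma4:
  fixes M :: "('s, 't) stat_model"
    and H0 :: "'t set" and h1 :: 't and \<Lambda> :: "'t pmf" and n :: nat
  assumes "finite_stat_model M"
    and "H0 \<subseteq> params M"
    and "h1 \<in> params M - H0"
    and "ratio_well_defined M H0 \<Lambda> h1"
    and "deterministic \<Lambda>"
    and "uniformly_least_favorable M H0 h1 \<Lambda>"
  shows "uniformly_least_favorable (iid_model n M) H0 h1 \<Lambda>"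
proof -
  obtain t where "set_pmf \<Lambda> = {t}"
    using assms(5) unfolding deterministic_def by (auto simp: card_1_singleton_iff)
  then have \<Lambda>: "\<Lambda> = return_pmf t" using set_pmf_subset_singleton by fastforce
  \<comment> \<open>Any level serves to see that \<open>t\<close> lies in \<open>H0\<close>.\<close>
  have "least_favorable M H0 h1 (1/2) \<Lambda>"
    using assms(6) by (simp add: uniformly_least_favorable_def)
  then have t: "t \<in> H0" by (simp add: least_favorable_def \<Lambda>)
  have finH0: "finite H0" and finS: "finite (samples M)"
    and sub: "\<And>h. h \<in> H0 \<Longrightarrow> set_pmf (dist M h) \<subseteq> samples M"
    using assms(1,2)
    by (auto simp: finite_stat_model_def stat_model_def intro: finite_subset)
  let ?r = "ratio M H0 (return_pmf t) h1"
  have fin: "finite (set_pmf (map_pmf ?r (dist M h)))" if "h \<in> H0" for h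
    using finite_subset[OF sub finS] that by auto
  have nonneg: "0 \<le> x" if "h \<in> H0" "x \<in> set_pmf (map_pmf ?r (dist M h))" for h x
    using that sub assms(4) by (fastforce simp: ratio_well_defined_def \<Lambda>)
  show ?thesis
    unfolding \<Lambda>
  proof (rule stochastically_le_imp_uniformly_least_favorable)
    fix h assume h: "h \<in> H0"
    have "stochastically_le (map_pmf ?r (dist M h)) (map_pmf ?r (dist M t))"
      by (rule uniformly_least_favorable_imp_stochastically_le)
        (use assms t h in \<open>auto simp: \<Lambda>\<close>)
    then have "stochastically_le (map_pmf prod_list (replicate_pmf n (map_pmf ?r (dist M h))))
        (map_pmf prod_list (replicate_pmf n (map_pmf ?r (dist M t))))"
      by (rule stochastically_le_prod_list) (use fin nonneg h t in auto)
    moreover have "h \<in> params M" "t \<in> params M" using h t assms(2) by auto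
    ultimately show
      "stochastically_le (map_pmf (ratio (iid_model n M) H0 (return_pmf t) h1) (dist (iid_model n M) h))
         (map_pmf (ratio (iid_model n M) H0 (return_pmf t) h1) (dist (iid_model n M) t))"
      by (simp add: map_ratio_iid_model[OF assms(1,2) t])
  next
    show "finite_stat_model (iid_model n M)"
      by (rule finite_stat_model_iid_model) (rule assms(1))
    show "ratio_well_defined (iid_model n M) H0 (return_pmf t) h1"
      using finH0 t assms(4) by (intro ratio_well_defined_iid_model) (auto simp: \<Lambda>)
  qed (use assms t in \<open>auto simp: iid_model_def\<close>)
qed

end
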